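(* Suppose $m=r$ (all workers are regular). Then the three-variable stochastic ADMM updates (1), (2), (3) described in the context can be simplified as $$x_i^{k+1}=x_i^k-\alpha_i^k\left(F'(x_i^k,\xi_i^k)+2\eta_i^k-\eta_i^{k-1}\right),$$ $$x_0^{k+1}=x_0^k-\alpha_0^k\Big(f_0'(x_0^k)-\sum_{i\in\mathcal{R}}(2\eta_i^k-\eta_i^{k-1})\Big),$$ $$\eta_i^{k+1}:=\eta^{k+1}(i,0)=-\eta^{k+1}(0,i)=\mathrm{proj}_\lambda\left(\eta_i^k+\frac{\beta}{2}\big(x_i^{k+1}-x_0^{k+1}\big)\right),$$ where $i\in\mathcal{R}$ and $\mathrm{proj}_\lambda(\cdot)$ is the projection operator that, for each dimension, maps any point in $\mathbb{R}$ onto $[-\lambda,\lambda]$.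
   Context: A distributed network has a master (index $0$) and $m$ workers; $\mathcal{R}$ is the set of regular workers and $|\mathcal{R}|=r$. For $i\in\mathcal{R}$, $F(\cdot,\xi_i)$ is the loss function on $\mathbb{R}^d$ of worker $i$ with respect to a random variable $\xi_i\sim\mathcal{D}_i$, and $F'(x_i^k,\xi_i^k)$ is the stochastic gradient at $x_i^k$ for the random sample $\xi_i^k$ of worker $i$ at time $k$. The function $f_0$ on $\mathbb{R}^d$ is a regularization term known to the master, with gradient $f_0'$. The numbers $\lambda,\beta$ are positive constants and $\sigma^k$ is a positive stepsize parameter. The problem being solved is $$\min_{x,z}\ \sum_{i\in\mathcal{R}}\big(\mathbb{E}[F(x_i,\xi_i)]+\lambda\|z(0,i)-z(i,0)\|_1\big)+f_0(x_0)\quad\text{s.t. } z(i,0)-x_0=0,\ z(0,i)-x_i=0,\ \forall i\in\mathcal{R}.$$ The variables are $x=(x_0,(x_i)_{i\in\mathcal{R}})$, $z=(z(i,0),z(0,i))_{i\in\mathcal{R}}$, and the Lagrange multipliers $\eta=(\eta(i,0),\eta(0,i))_{i\in\mathcal{R}}$ attached to the constraints $z(i,0)-x_0=0$ and $z(0,i)-x_i=0$ respectively; all blocks lie in $\mathbb{R}^d$. The augmented Lagrangian is $$\mathcal{L}_\beta(x,z,\eta)=\sum_{i\in\mathcal{R}}\big(\mathbb{E}[F(x_i,\xi_i)]+\lambda\|z(0,i)-z(i,0)\|_1\big)+f_0(x_0)+\sum_{i\in\mathcal{R}}\Big(\langle\eta(i,0),z(i,0)-x_0\rangle+\frac\beta2\|z(i,0)-x_0\|^2\Big)+\sum_{i\in\mathcal{R}}\Big(\langle\eta(0,i),z(0,i)-x_i\rangle+\frac\beta2\|z(0,i)-x_i\|^2\Big).$$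 Put $\alpha_i^k=\frac1{\sigma^k+\beta}$ for $i\in\mathcal{R}$ and $\alpha_0^k=\frac1{\sigma^k+\sum_{i\in\mathcal{R}}\beta}$ (which is $\frac1{\sigma^k+m\beta}$ when $m=r$). Three-variable stochastic ADMM updates at time $k$: (1) $x$-update (explicit minimizer of a stochastic first-order approximation of the augmented Lagrangian): $$x_i^{k+1}=x_i^k-\alpha_i^k\big(F'(x_i^k,\xi_i^k)+\beta x_i^k-\beta z^k(0,i)-\eta^k(0,i)\big),\quad i\in\mathcal{R},$$ $$x_0^{k+1}=x_0^k-\alpha_0^k\Big(f_0'(x_0^k)+\sum_{i\in\mathcal{R}}\big(\beta x_0^k-\beta z^k(i,0)-\eta^k(i,0)\big)\Big).$$ (2) $z$-update: $z^{k+1}=\arg\min_z\mathcal{L}_\beta(x^{k+1},z,\eta^k)$. (3) $\eta$-update: $$\eta^{k+1}(i,0)=\eta^k(i,0)+\beta\big(z^{k+1}(i,0)-x_0^{k+1}\big),\qquad \eta^{k+1}(0,i)=\eta^k(0,i)+\beta\big(z^{k+1}(0,i)-x_i^{k+1}\big),\quad i\in\mathcal{R}.$$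
   Formalization: The η-formula at k=0 and worker x-formula at k=1 assume η^0(i,0)=-η^0(0,i), without which they can fail; both x-formulas at k=0, where η^{-1} is undefined, assume this too and use any η^{-1} with η^{-1}(i,0)=-η^{-1}(0,i) from which update (3) yields η^0. *)

theory Defs
  imports "HOL-Probability.Probability"
begin

definition l1_norm :: "real ^ 'd \<Rightarrow> real" where
  "l1_norm v = (\<Sum>j\<in>UNIV. \<bar>v $ j\<bar>)"

definition proj :: "real \<Rightarrow> real ^ 'd \<Rightarrow> real ^ 'd" where
  "proj lam v = (\<chi> j. closest_point {-lam..lam} (v $ j))"

definition alpha_worker :: "real \<Rightarrow> real \<Rightarrow> real" where
  "alpha_worker \<beta> s = 1 / (s + \<beta>)"

definition alpha_master :: "nat set \<Rightarrow> real \<Rightarrow> real \<Rightarrow> real" where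
  "alpha_master R \<beta> s = 1 / (s + (\<Sum>i\<in>R. \<beta>))"

text \<open>
  The master is node 0 and the workers are nodes 1 to m. A block vector is a total function on
  nodes (for x) or on pairs of nodes (for z and the multipliers); only its values at 0 and the
  i in R, respectively at the pairs (i, 0) and (0, i) with i in R, are used. In particular the
  values of z at all other pairs do not affect the augmented Lagrangian, and a minimizer over z
  is unconstrained there.
\<close>

definition aug_lagrangian ::
  "nat set \<Rightarrow> (nat \<Rightarrow> 's measure) \<Rightarrow> (real ^ 'd \<Rightarrow> 's \<Rightarrow> real) \<Rightarrow> (real ^ 'd \<Rightarrow> real)
    \<Rightarrow> real \<Rightarrow> real \<Rightarrow> (nat \<Rightarrow> real ^ 'd) \<Rightarrow> (nat \<times> nat \<Rightarrow> real ^ 'd) \<Rightarrow> (nat \<times> nat \<Rightarrow> real ^ 'd) \<Rightarrow> real"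
  where
  "aug_lagrangian R D F f0 lam \<beta> x z \<eta> =
     (\<Sum>i\<in>R. (\<integral>\<xi>. F (x i) \<xi> \<partial>(D i)) + lam * l1_norm (z (0, i) - z (i, 0))) + f0 (x 0)
   + (\<Sum>i\<in>R. \<eta> (i, 0) \<bullet> (z (i, 0) - x 0) + \<beta> / 2 * (norm (z (i, 0) - x 0))\<^sup>2)
   + (\<Sum>i\<in>R. \<eta> (0, i) \<bullet> (z (0, i) - x i) + \<beta> / 2 * (norm (z (0, i) - x i))\<^sup>2)"

end

theory Submission
  imports Defs
begin

text \<open>
  The expectations and the regularizer do not depend on z, and the remaining part of the augmented
  Lagrangian splits into one strongly convex problem for each pair of blocks z(i,0), z(0,i). The
  gradients of the smooth terms of this problem at its minimizer are exactly the updated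
  multipliers \<open>\<eta>\<close>(i,0) and \<open>\<eta>\<close>(0,i).

  The whole z-step is therefore captured by how the Lagrangian changes under a displacement of one
  pair of blocks (\<open>aug_lagrangian_shift\<close>). Two families of displacements suffice. Moving both blocks
  by the same vector leaves the \<open>\<ell>\<^sub>1\<close> term unchanged, so the two gradients cancel:
  the new multipliers are opposite (\<open>minimizer_gradients_opposite\<close>). Moving a single coordinate of
  z(i,0) shows that the new \<open>\<eta>\<close>(i,0) is a subgradient of \<open>lam\<close> times the absolute value at
  z(0,i) - z(i,0), coordinate by coordinate. That subgradient condition is the variational
  characterization of a projection onto \<open>[-lam, lam]\<close>
  (\<open>abs_subgradient_eq_closest_point\<close>). When the old multipliers are opposite as well, halving the
  difference of the two multiplier updates identifies the projected point as
  \<open>\<eta>\<close>(i,0) + \<open>\<beta>\<close>/2 (x(i) - x(0)), free of z (\<open>multiplier_update_eq_proj\<close>).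

  In the x-updates, z enters only through \<open>\<beta>\<close>(x - z), which by the multiplier update is the previous
  multiplier minus the current one. The worker formula needs opposite multipliers at both times,
  which holds at every time after a z-step but is an extra condition on the initial values.
\<close>

section \<open>Subgradients of the absolute value and projection onto an interval\<close>

text \<open>The first-order part of a quadratic perturbation dominates as the step size tends to 0.\<close>

lemma linear_coefficient_nonneg:
  fixes A B :: real
  assumes "\<And>s. 0 < s \<Longrightarrow> s \<le> 1 \<Longrightarrow> 0 \<le> s * A + s\<^sup>2 * B"
  shows "0 \<le> A"
proof (rule tendsto_lowerbound)
  have "((\<lambda>s. A + s * B) \<longlongrightarrow> A + 0 * B) (at_right 0)"
    by (intro tendsto_intros)
  then show "((\<lambda>s. A + s * B) \<longlongrightarrow> A) (at_right 0)"
    by simp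
  have "0 \<le> A + s * B" if "0 < s" "s < 1" for s
  proof -
    have "0 \<le> s * (A + s * B)"
      using assms[of s] that by (simp add: algebra_simps power2_eq_square)
    then show ?thesis
      using that by (simp add: zero_le_mult_iff)
  qed
  then show "\<forall>\<^sub>F s in at_right 0. 0 \<le> A + s * B"
    unfolding eventually_at_right[OF zero_less_one] by (intro exI[of _ 1]) simp
qed simp

text \<open>
  The optimality condition at \<open>t = 0\<close> of a convex function plus a quadratic: the quadratic term can be
  dropped, because shrinking a displacement scales it by a higher order than the convex part.
\<close>

lemma abs_first_order_optimality:
  fixes lam c d g t :: real
  assumes lam: "0 \<le> lam"
    and minimal: "\<And>t. 0 \<le> lam * (\<bar>d - t\<bar> - \<bar>d\<bar>) + g * t + c * t\<^sup>2"
  shows "0 \<le> lam * (\<bar>d - t\<bar> - \<bar>d\<bar>) + g * t"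
proof (rule linear_coefficient_nonneg)
  fix s :: real
  assume s: "0 < s" "s \<le> 1"
  have "d - s * t = (1 - s) * d + s * (d - t)"
    by (simp add: algebra_simps)
  then have "\<bar>d - s * t\<bar> \<le> \<bar>(1 - s) * d\<bar> + \<bar>s * (d - t)\<bar>"
    by (metis abs_triangle_ineq)
  then have "\<bar>d - s * t\<bar> \<le> (1 - s) * \<bar>d\<bar> + s * \<bar>d - t\<bar>"
    using s by (simp add: abs_mult)
  then have "\<bar>d - s * t\<bar> - \<bar>d\<bar> \<le> s * (\<bar>d - t\<bar> - \<bar>d\<bar>)"
    by (simp add: algebra_simps)
  then have "lam * (\<bar>d - s * t\<bar> - \<bar>d\<bar>) \<le> lam * (s * (\<bar>d - t\<bar> - \<bar>d\<bar>))"
    using lam by (rule mult_left_mono)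
  with minimal[of "s * t"]
  show "0 \<le> s * (lam * (\<bar>d - t\<bar> - \<bar>d\<bar>) + g * t) + s\<^sup>2 * (c * t\<^sup>2)"
    by (simp add: algebra_simps power_mult_distrib)
qed

text \<open>
  A subgradient \<open>g\<close> of \<open>lam * \<bar>_\<bar>\<close> at \<open>d\<close> lies in \<open>[-lam, lam]\<close> and satisfies \<open>g * d = lam * \<bar>d\<bar>\<close>, so \<open>d\<close>
  points in an outward normal direction of this interval at \<open>g\<close>; moving from \<open>g\<close> along a normal
  does not change the closest point.
\<close>

lemma abs_subgradient_eq_closest_point:
  fixes lam c d g :: real
  assumes lam: "0 \<le> lam" and c: "0 \<le> c"
    and subgradient: "\<And>t. 0 \<le> lam * (\<bar>d - t\<bar> - \<bar>d\<bar>) + g * t"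
  shows "g = closest_point {-lam..lam} (g + c * d)"
proof (rule closest_point_unique)
  have bound: "0 \<le> lam * \<bar>t\<bar> + g * t" for t
  proof -
    have "lam * (\<bar>d - t\<bar> - \<bar>d\<bar>) \<le> lam * \<bar>t\<bar>"
      using lam by (intro mult_left_mono) auto
    with subgradient[of t] show ?thesis
      by linarith
  qed
  show "g \<in> {-lam..lam}"
    using bound[of 1] bound[of "-1"] by simp
  have complementary: "lam * \<bar>d\<bar> \<le> g * d"
    using subgradient[of d] by simp
  show "\<forall>y\<in>{-lam..lam}. dist (g + c * d) g \<le> dist (g + c * d) y"
  proof
    fix y
    assume "y \<in> {-lam..lam}"
    then have "\<bar>y\<bar> * \<bar>d\<bar> \<le> lam * \<bar>d\<bar>"
      by (intro mult_right_mono) auto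
    moreover have "y * d \<le> \<bar>y\<bar> * \<bar>d\<bar>"
      by (metis abs_ge_self abs_mult)
    ultimately have "0 \<le> c * (g * d - y * d)"
      using complementary c by (intro mult_nonneg_nonneg) auto
    then have "0 \<le> 2 * (c * (g * d - y * d)) + (g - y)\<^sup>2"
      by simp
    then have "(c * d)\<^sup>2 \<le> (g + c * d - y)\<^sup>2"
      by (simp add: power2_eq_square algebra_simps)
    then show "dist (g + c * d) g \<le> dist (g + c * d) y"
      by (simp add: dist_real_def abs_le_square_iff)
  qed
qed auto

section \<open>Displacing one pair of blocks in the augmented Lagrangian\<close>

lemma sum_diff_single:
  fixes f g :: "'a \<Rightarrow> 'b::ab_group_add"
  assumes "finite A" "i \<in> A" "\<And>j. j \<in> A \<Longrightarrow> j \<noteq> i \<Longrightarrow> f j = g j"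
  shows "sum f A - sum g A = f i - g i"
proof -
  have "sum f (A - {i}) = sum g (A - {i})"
    using assms(3) by (intro sum.cong) auto
  then show ?thesis
    using assms(1,2) by (simp add: sum.remove)
qed

lemma l1_norm_diff_axis:
  fixes v :: "real ^ 'd"
  shows "l1_norm (v - axis j t) - l1_norm v = \<bar>v $ j - t\<bar> - \<bar>v $ j\<bar>"
  unfolding l1_norm_def by (subst sum_diff_single[where i = j]) (auto simp: axis_def)

lemma penalty_shift:
  fixes e v h :: "'a::real_inner"
  shows "e \<bullet> (v + h) + \<beta> / 2 * (norm (v + h))\<^sup>2 - (e \<bullet> v + \<beta> / 2 * (norm v)\<^sup>2)
    = (e + \<beta> *\<^sub>R v) \<bullet> h + \<beta> / 2 * (norm h)\<^sup>2"
  unfolding power2_norm_eq_inner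
  by (simp add: inner_add_left inner_add_right inner_commute algebra_simps)

text \<open>
  The displaced z agrees with the old one at the blocks of all other workers, and as the master is not
  a worker the two displaced blocks are distinct.
\<close>

lemma aug_lagrangian_shift:
  fixes x :: "nat \<Rightarrow> real ^ 'd" and z \<eta> :: "nat \<times> nat \<Rightarrow> real ^ 'd"
  assumes R: "finite R" "0 \<notin> R" "i \<in> R"
  shows "aug_lagrangian R D F f0 lam \<beta> x (z((i, 0) := z (i, 0) + g, (0, i) := z (0, i) + h)) \<eta>
      - aug_lagrangian R D F f0 lam \<beta> x z \<eta>
    = lam * (l1_norm (z (0, i) - z (i, 0) + h - g) - l1_norm (z (0, i) - z (i, 0)))
      + ((\<eta> (i, 0) + \<beta> *\<^sub>R (z (i, 0) - x 0)) \<bullet> g + \<beta> / 2 * (norm g)\<^sup>2)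
      + ((\<eta> (0, i) + \<beta> *\<^sub>R (z (0, i) - x i)) \<bullet> h + \<beta> / 2 * (norm h)\<^sup>2)"
proof -
  define w where "w = z((i, 0) := z (i, 0) + g, (0, i) := z (0, i) + h)"
  have i: "i \<noteq> 0"
    using R by metis
  have w: "w (i, 0) = z (i, 0) + g" "w (0, i) = z (0, i) + h"
    using i by (simp_all add: w_def)
  have unchanged: "w (j, 0) = z (j, 0)" "w (0, j) = z (0, j)" if "j \<noteq> i" for j
    using that i by (auto simp: w_def)
  define E where "E u j = (\<integral>\<xi>. F (x j) \<xi> \<partial>(D j)) + lam * l1_norm (u (0, j) - u (j, 0))"
    for u :: "nat \<times> nat \<Rightarrow> real ^ 'd" and j
  define P where "P u j = \<eta> (j, 0) \<bullet> (u (j, 0) - x 0) + \<beta> / 2 * (norm (u (j, 0) - x 0))\<^sup>2"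
    for u :: "nat \<times> nat \<Rightarrow> real ^ 'd" and j
  define Q where "Q u j = \<eta> (0, j) \<bullet> (u (0, j) - x j) + \<beta> / 2 * (norm (u (0, j) - x j))\<^sup>2"
    for u :: "nat \<times> nat \<Rightarrow> real ^ 'd" and j
  have "sum (E w) R - sum (E z) R = E w i - E z i"
    "sum (P w) R - sum (P z) R = P w i - P z i"
    "sum (Q w) R - sum (Q z) R = Q w i - Q z i"
    using R by (intro sum_diff_single; simp add: unchanged E_def P_def Q_def)+
  moreover have "aug_lagrangian R D F f0 lam \<beta> x u \<eta> = sum (E u) R + f0 (x 0) + sum (P u) R + sum (Q u) R"
    for u
    by (simp add: aug_lagrangian_def E_def P_def Q_def)
  ultimately have "aug_lagrangian R D F f0 lam \<beta> x w \<eta> - aug_lagrangian R D F f0 lam \<beta> x z \<eta>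
      = (E w i - E z i) + (P w i - P z i) + (Q w i - Q z i)"
    by simp
  moreover have "E w i - E z i
      = lam * (l1_norm (z (0, i) - z (i, 0) + h - g) - l1_norm (z (0, i) - z (i, 0)))"
    by (simp add: E_def w algebra_simps)
  moreover have "P w i - P z i = (\<eta> (i, 0) + \<beta> *\<^sub>R (z (i, 0) - x 0)) \<bullet> g + \<beta> / 2 * (norm g)\<^sup>2"
    using penalty_shift[of "\<eta> (i, 0)" "z (i, 0) - x 0" g \<beta>]
    by (simp add: P_def w add_diff_eq add.commute diff_add_eq)
  moreover have "Q w i - Q z i = (\<eta> (0, i) + \<beta> *\<^sub>R (z (0, i) - x i)) \<bullet> h + \<beta> / 2 * (norm h)\<^sup>2"
    using penalty_shift[of "\<eta> (0, i)" "z (0, i) - x i" h \<beta>]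
    by (simp add: Q_def w add_diff_eq add.commute diff_add_eq)
  ultimately show ?thesis
    by (simp add: w_def)
qed

lemma minimizer_shift_nonneg:
  fixes x :: "nat \<Rightarrow> real ^ 'd" and z \<eta> :: "nat \<times> nat \<Rightarrow> real ^ 'd"
  assumes "finite R" "0 \<notin> R" "i \<in> R"
    and "is_arg_min (\<lambda>w. aug_lagrangian R D F f0 lam \<beta> x w \<eta>) (\<lambda>w. True) z"
  shows "0 \<le> lam * (l1_norm (z (0, i) - z (i, 0) + h - g) - l1_norm (z (0, i) - z (i, 0)))
      + ((\<eta> (i, 0) + \<beta> *\<^sub>R (z (i, 0) - x 0)) \<bullet> g + \<beta> / 2 * (norm g)\<^sup>2)
      + ((\<eta> (0, i) + \<beta> *\<^sub>R (z (0, i) - x i)) \<bullet> h + \<beta> / 2 * (norm h)\<^sup>2)"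
  unfolding aug_lagrangian_shift[OF assms(1-3), symmetric, where D = D and F = F and ?f0.0 = f0]
  using assms(4) by (simp add: is_arg_min_linorder)

section \<open>Multipliers after a z-step\<close>

text \<open>
  Translating both blocks by a small multiple of minus the sum of the two gradients keeps their
  difference and would decrease the Lagrangian to first order if that sum were nonzero.
\<close>

lemma minimizer_gradients_opposite:
  fixes x :: "nat \<Rightarrow> real ^ 'd" and z \<eta> :: "nat \<times> nat \<Rightarrow> real ^ 'd"
  assumes R: "finite R" "0 \<notin> R" "i \<in> R"
    and minimizer: "is_arg_min (\<lambda>w. aug_lagrangian R D F f0 lam \<beta> x w \<eta>) (\<lambda>w. True) z"
  shows "\<eta> (i, 0) + \<beta> *\<^sub>R (z (i, 0) - x 0) = - (\<eta> (0, i) + \<beta> *\<^sub>R (z (0, i) - x i))"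
proof -
  define p where "p = \<eta> (i, 0) + \<beta> *\<^sub>R (z (i, 0) - x 0)"
  define q where "q = \<eta> (0, i) + \<beta> *\<^sub>R (z (0, i) - x i)"
  define n where "n = p + q"
  have "0 \<le> - (norm n)\<^sup>2"
  proof (rule linear_coefficient_nonneg)
    fix s :: real
    have "p \<bullet> (- s *\<^sub>R n) + q \<bullet> (- s *\<^sub>R n) = - s * (norm n)\<^sup>2"
      unfolding inner_add_left[symmetric] n_def[symmetric] by (simp add: power2_norm_eq_inner)
    then show "0 \<le> s * - (norm n)\<^sup>2 + s\<^sup>2 * (\<beta> * (norm n)\<^sup>2)"
      using minimizer_shift_nonneg[OF R minimizer, of "- s *\<^sub>R n" "- s *\<^sub>R n"]
      unfolding p_def[symmetric] q_def[symmetric] by (simp add: power_mult_distrib algebra_simps)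
  qed
  then have "p + q = 0"
    by (simp add: n_def)
  then show ?thesis
    unfolding p_def[symmetric] q_def[symmetric] by (simp only: eq_neg_iff_add_eq_0)
qed

text \<open>
  Displacing z(i,0) alone, along one axis, changes a single summand of the \<open>\<ell>\<^sub>1\<close> term and so reduces
  optimality to a problem on the real line.
\<close>

lemma minimizer_gradient_subgradient:
  fixes x :: "nat \<Rightarrow> real ^ 'd" and z \<eta> :: "nat \<times> nat \<Rightarrow> real ^ 'd"
  assumes R: "finite R" "0 \<notin> R" "i \<in> R"
    and minimizer: "is_arg_min (\<lambda>w. aug_lagrangian R D F f0 lam \<beta> x w \<eta>) (\<lambda>w. True) z"
    and lam: "0 \<le> lam"
  shows "0 \<le> lam * (\<bar>(z (0, i) - z (i, 0)) $ j - t\<bar> - \<bar>(z (0, i) - z (i, 0)) $ j\<bar>)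
    + (\<eta> (i, 0) + \<beta> *\<^sub>R (z (i, 0) - x 0)) $ j * t"
proof (rule abs_first_order_optimality[OF lam, where c = "\<beta> / 2"])
  fix t :: real
  show "0 \<le> lam * (\<bar>(z (0, i) - z (i, 0)) $ j - t\<bar> - \<bar>(z (0, i) - z (i, 0)) $ j\<bar>)
    + (\<eta> (i, 0) + \<beta> *\<^sub>R (z (i, 0) - x 0)) $ j * t + \<beta> / 2 * t\<^sup>2"
    using minimizer_shift_nonneg[OF R minimizer, of 0 "axis j t"]
    unfolding power2_norm_eq_inner
    by (simp add: l1_norm_diff_axis inner_axis inner_axis_axis power2_eq_square
        del: vector_minus_component)
qed

text \<open>
  With opposite multipliers before and after the step, the new \<open>\<eta>\<close>(i,0) is half the difference of the
  two updated multipliers. Hence \<open>\<eta>\<close>(i,0) + \<open>\<beta>\<close>/2 (x(i) - x(0)) exceeds it by \<open>\<beta>\<close>/2 times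
  z(0,i) - z(i,0), the point at which it is a subgradient.
\<close>

lemma multiplier_update_eq_proj:
  fixes x :: "nat \<Rightarrow> real ^ 'd" and z \<eta> :: "nat \<times> nat \<Rightarrow> real ^ 'd"
  assumes R: "finite R" "0 \<notin> R" "i \<in> R"
    and minimizer: "is_arg_min (\<lambda>w. aug_lagrangian R D F f0 lam \<beta> x w \<eta>) (\<lambda>w. True) z"
    and positive: "0 \<le> lam" "0 \<le> \<beta>"
    and opposite: "\<eta> (i, 0) = - \<eta> (0, i)"
  shows "\<eta> (i, 0) + \<beta> *\<^sub>R (z (i, 0) - x 0) = proj lam (\<eta> (i, 0) + (\<beta> / 2) *\<^sub>R (x i - x 0))"
proof -
  define p where "p = \<eta> (i, 0) + \<beta> *\<^sub>R (z (i, 0) - x 0)"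
  define d where "d = z (0, i) - z (i, 0)"
  have "(\<eta> (i, 0) + (\<beta> / 2) *\<^sub>R (x i - x 0)) $ j = p $ j + \<beta> / 2 * d $ j" for j
  proof -
    have "p $ j = - (\<eta> (0, i) + \<beta> *\<^sub>R (z (0, i) - x i)) $ j"
      using minimizer_gradients_opposite[OF R minimizer] by (simp add: p_def)
    then show ?thesis
      using opposite by (simp add: p_def d_def algebra_simps)
  qed
  moreover have "p $ j = closest_point {-lam..lam} (p $ j + \<beta> / 2 * d $ j)" for j
    using positive minimizer_gradient_subgradient[OF R minimizer positive(1)]
    unfolding p_def d_def by (intro abs_subgradient_eq_closest_point) auto
  ultimately show ?thesis
    unfolding p_def[symmetric] by (simp add: proj_def vec_eq_iff)
qed

section \<open>The simplified updates\<close>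

theorem proposition1:
  fixes m r :: nat and R :: "nat set"
    and D :: "nat \<Rightarrow> 's measure"
    and F :: "real ^ 'd \<Rightarrow> 's \<Rightarrow> real" and F' :: "real ^ 'd \<Rightarrow> 's \<Rightarrow> real ^ 'd"
    and f0 :: "real ^ 'd \<Rightarrow> real" and f0' :: "real ^ 'd \<Rightarrow> real ^ 'd"
    and lam \<beta> :: real and \<sigma> :: "nat \<Rightarrow> real"
    and \<xi> :: "nat \<Rightarrow> nat \<Rightarrow> 's"
    and x :: "nat \<Rightarrow> nat \<Rightarrow> real ^ 'd"
    and z \<eta> :: "nat \<Rightarrow> nat \<times> nat \<Rightarrow> real ^ 'd"
  assumes regular: "R \<subseteq> {1..m}" "card R = r"
    and all_regular: "m = r"
    and distribution: "\<And>i. i \<in> R \<Longrightarrow> prob_space (D i)"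
    and expectation: "\<And>i y. i \<in> R \<Longrightarrow> integrable (D i) (F y)"
    and sample: "\<And>k i. i \<in> R \<Longrightarrow> \<xi> k i \<in> space (D i)"
    and stochastic_gradient:
      "\<And>k i. i \<in> R \<Longrightarrow> GDERIV (\<lambda>y. F y (\<xi> k i)) (x k i) :> F' (x k i) (\<xi> k i)"
    and regularizer_gradient: "\<And>y. GDERIV f0 y :> f0' y"
    and positive: "lam > 0" "\<beta> > 0" "\<And>k. \<sigma> k > 0"
    and x_update_worker: "\<And>k i. i \<in> R \<Longrightarrow>
      x (Suc k) i = x k i - alpha_worker \<beta> (\<sigma> k) *\<^sub>R
        (F' (x k i) (\<xi> k i) + \<beta> *\<^sub>R x k i - \<beta> *\<^sub>R z k (0, i) - \<eta> k (0, i))"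
    and x_update_master: "\<And>k.
      x (Suc k) 0 = x k 0 - alpha_master R \<beta> (\<sigma> k) *\<^sub>R
        (f0' (x k 0) + (\<Sum>i\<in>R. \<beta> *\<^sub>R x k 0 - \<beta> *\<^sub>R z k (i, 0) - \<eta> k (i, 0)))"
    and z_update: "\<And>k.
      is_arg_min (\<lambda>w. aug_lagrangian R D F f0 lam \<beta> (x (Suc k)) w (\<eta> k)) (\<lambda>w. True) (z (Suc k))"
    and eta_update_master: "\<And>k i. i \<in> R \<Longrightarrow>
      \<eta> (Suc k) (i, 0) = \<eta> k (i, 0) + \<beta> *\<^sub>R (z (Suc k) (i, 0) - x (Suc k) 0)"
    and eta_update_worker: "\<And>k i. i \<in> R \<Longrightarrow>
      \<eta> (Suc k) (0, i) = \<eta> k (0, i) + \<beta> *\<^sub>R (z (Suc k) (0, i) - x (Suc k) i)"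
  shows
    "(\<comment> \<open>worker update; at k = 1 it involves the initial multipliers\<close>
      \<forall>k\<ge>1. \<forall>i\<in>R. k \<ge> 2 \<or> \<eta> 0 (i, 0) = - \<eta> 0 (0, i) \<longrightarrow>
        x (Suc k) i = x k i - alpha_worker \<beta> (\<sigma> k) *\<^sub>R
          (F' (x k i) (\<xi> k i) + 2 *\<^sub>R \<eta> k (i, 0) - \<eta> (k - 1) (i, 0)))
   \<and> (\<forall>k\<ge>1. x (Suc k) 0 = x k 0 - alpha_master R \<beta> (\<sigma> k) *\<^sub>R
          (f0' (x k 0) - (\<Sum>i\<in>R. 2 *\<^sub>R \<eta> k (i, 0) - \<eta> (k - 1) (i, 0))))
   \<and> (\<forall>k. \<forall>i\<in>R. \<eta> (Suc k) (i, 0) = - \<eta> (Suc k) (0, i))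
   \<and> (\<forall>k. \<forall>i\<in>R. k \<ge> 1 \<or> \<eta> 0 (i, 0) = - \<eta> 0 (0, i) \<longrightarrow>
        \<eta> (Suc k) (i, 0) = proj lam (\<eta> k (i, 0) + (\<beta> / 2) *\<^sub>R (x (Suc k) i - x (Suc k) 0)))
   \<and> (\<comment> \<open>first x-update, for any multipliers at time -1 from which the multiplier update yields the initial ones\<close>
      \<forall>\<eta>m. (\<forall>i\<in>R. \<eta>m (i, 0) = - \<eta>m (0, i)
             \<and> \<eta> 0 (i, 0) = \<eta>m (i, 0) + \<beta> *\<^sub>R (z 0 (i, 0) - x 0 0)
             \<and> \<eta> 0 (0, i) = \<eta>m (0, i) + \<beta> *\<^sub>R (z 0 (0, i) - x 0 i))
           \<and> (\<forall>i\<in>R. \<eta> 0 (i, 0) = - \<eta> 0 (0, i)) \<longrightarrow>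
        (\<forall>i\<in>R. x 1 i = x 0 i - alpha_worker \<beta> (\<sigma> 0) *\<^sub>R
          (F' (x 0 i) (\<xi> 0 i) + 2 *\<^sub>R \<eta> 0 (i, 0) - \<eta>m (i, 0)))
        \<and> x 1 0 = x 0 0 - alpha_master R \<beta> (\<sigma> 0) *\<^sub>R
          (f0' (x 0 0) - (\<Sum>i\<in>R. 2 *\<^sub>R \<eta> 0 (i, 0) - \<eta>m (i, 0))))"
proof -
  have finite: "finite R" and no_master: "0 \<notin> R"
    using regular(1) finite_subset by auto
  have opposite: "\<eta> (Suc k) (i, 0) = - \<eta> (Suc k) (0, i)" if "i \<in> R" for k i
    using minimizer_gradients_opposite[OF finite no_master that z_update]
    by (simp add: eta_update_master eta_update_worker that)
  have projection: "\<eta> (Suc k) (i, 0) = proj lam (\<eta> k (i, 0) + (\<beta> / 2) *\<^sub>R (x (Suc k) i - x (Suc k) 0))"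
    if "i \<in> R" "\<eta> k (i, 0) = - \<eta> k (0, i)" for k i
    using multiplier_update_eq_proj[OF finite no_master that(1) z_update _ _ that(2)] positive
    by (simp add: eta_update_master that(1))
  \<comment> \<open>Both x-updates are stated for arbitrary preceding multipliers, so that they also cover the
    first step, where these are hypothetical multipliers at time -1.\<close>
  have worker: "x (Suc k) i = x k i - alpha_worker \<beta> (\<sigma> k) *\<^sub>R
      (F' (x k i) (\<xi> k i) + 2 *\<^sub>R \<eta> k (i, 0) - e (i, 0))"
    if "i \<in> R" "\<eta> k (i, 0) = - \<eta> k (0, i)" "e (i, 0) = - e (0, i)"
      "\<eta> k (0, i) = e (0, i) + \<beta> *\<^sub>R (z k (0, i) - x k i)" for k i and e :: "nat \<times> nat \<Rightarrow> real ^ 'd"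
  proof -
    have "F' (x k i) (\<xi> k i) + \<beta> *\<^sub>R x k i - \<beta> *\<^sub>R z k (0, i) - \<eta> k (0, i)
        = F' (x k i) (\<xi> k i) + e (0, i) - 2 *\<^sub>R \<eta> k (0, i)"
      using that(4) by (simp add: algebra_simps scaleR_2)
    also have "\<dots> = F' (x k i) (\<xi> k i) + 2 *\<^sub>R \<eta> k (i, 0) - e (i, 0)"
      using that(2,3) by simp
    finally show ?thesis
      by (simp add: x_update_worker[OF that(1)])
  qed
  have master: "x (Suc k) 0 = x k 0 - alpha_master R \<beta> (\<sigma> k) *\<^sub>R
      (f0' (x k 0) - (\<Sum>i\<in>R. 2 *\<^sub>R \<eta> k (i, 0) - e (i, 0)))"
    if "\<And>i. i \<in> R \<Longrightarrow> \<eta> k (i, 0) = e (i, 0) + \<beta> *\<^sub>R (z k (i, 0) - x k 0)"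
    for k and e :: "nat \<times> nat \<Rightarrow> real ^ 'd"
  proof -
    have "(\<Sum>i\<in>R. \<beta> *\<^sub>R x k 0 - \<beta> *\<^sub>R z k (i, 0) - \<eta> k (i, 0))
        = (\<Sum>i\<in>R. - (2 *\<^sub>R \<eta> k (i, 0) - e (i, 0)))"
      using that by (intro sum.cong) (simp_all add: algebra_simps scaleR_2)
    then show ?thesis
      by (simp add: x_update_master sum_negf del: minus_diff_eq)
  qed
  show ?thesis
  proof (intro conjI allI impI ballI)
    fix k i :: nat
    assume k: "1 \<le> k" and i: "i \<in> R" and initial: "2 \<le> k \<or> \<eta> 0 (i, 0) = - \<eta> 0 (0, i)"
    then obtain l where l: "k = Suc l"
      by (cases k) auto
    have "\<eta> l (i, 0) = - \<eta> l (0, i)"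
      using initial i opposite l by (cases l) auto
    with i l show "x (Suc k) i = x k i - alpha_worker \<beta> (\<sigma> k) *\<^sub>R
        (F' (x k i) (\<xi> k i) + 2 *\<^sub>R \<eta> k (i, 0) - \<eta> (k - 1) (i, 0))"
      by (intro worker) (simp_all only: opposite eta_update_worker diff_Suc_1)
  next
    fix k :: nat
    assume "1 \<le> k"
    then obtain l where "k = Suc l"
      by (cases k) auto
    then show "x (Suc k) 0 = x k 0 - alpha_master R \<beta> (\<sigma> k) *\<^sub>R
        (f0' (x k 0) - (\<Sum>i\<in>R. 2 *\<^sub>R \<eta> k (i, 0) - \<eta> (k - 1) (i, 0)))"
      by (intro master) (simp only: eta_update_master diff_Suc_1)
  next
    fix k i
    assume "i \<in> R"
    then show "\<eta> (Suc k) (i, 0) = - \<eta> (Suc k) (0, i)"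
      by (rule opposite)
  next
    fix k i :: nat
    assume i: "i \<in> R" and "1 \<le> k \<or> \<eta> 0 (i, 0) = - \<eta> 0 (0, i)"
    then have "\<eta> k (i, 0) = - \<eta> k (0, i)"
      using opposite by (cases k) auto
    with i show "\<eta> (Suc k) (i, 0) = proj lam (\<eta> k (i, 0) + (\<beta> / 2) *\<^sub>R (x (Suc k) i - x (Suc k) 0))"
      by (rule projection)
  next
    fix e :: "nat \<times> nat \<Rightarrow> real ^ 'd" and i
    assume "(\<forall>i\<in>R. e (i, 0) = - e (0, i)
        \<and> \<eta> 0 (i, 0) = e (i, 0) + \<beta> *\<^sub>R (z 0 (i, 0) - x 0 0)
        \<and> \<eta> 0 (0, i) = e (0, i) + \<beta> *\<^sub>R (z 0 (0, i) - x 0 i))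
      \<and> (\<forall>i\<in>R. \<eta> 0 (i, 0) = - \<eta> 0 (0, i))" and "i \<in> R"
    then show "x 1 i = x 0 i - alpha_worker \<beta> (\<sigma> 0) *\<^sub>R
        (F' (x 0 i) (\<xi> 0 i) + 2 *\<^sub>R \<eta> 0 (i, 0) - e (i, 0))"
      unfolding One_nat_def by (intro worker) blast+
  next
    fix e :: "nat \<times> nat \<Rightarrow> real ^ 'd"
    assume "(\<forall>i\<in>R. e (i, 0) = - e (0, i)
        \<and> \<eta> 0 (i, 0) = e (i, 0) + \<beta> *\<^sub>R (z 0 (i, 0) - x 0 0)
        \<and> \<eta> 0 (0, i) = e (0, i) + \<beta> *\<^sub>R (z 0 (0, i) - x 0 i))
      \<and> (\<forall>i\<in>R. \<eta> 0 (i, 0) = - \<eta> 0 (0, i))"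
    then show "x 1 0 = x 0 0 - alpha_master R \<beta> (\<sigma> 0) *\<^sub>R
        (f0' (x 0 0) - (\<Sum>i\<in>R. 2 *\<^sub>R \<eta> 0 (i, 0) - e (i, 0)))"
      unfolding One_nat_def by (intro master) blast
  qed
qed

end
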